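(* Let $n\ge 3$, let $G=C_{n,n}$ be the crown graph on $[2n]$ with bipartition $X=\{1,3,\ldots,2n-1\}$, $Y=\{2,4,\ldots,2n\}$, and let $T\subseteq[2n]$ be a nonempty set. (1) If $T\subseteq X$, then $T\in\mathcal{C}(G)$ if and only if either $T=X$ or $T=X\setminus\{2i-1\}$ for some $i\in[n]$. (2) If $T\subseteq Y$, then $T\in\mathcal{C}(G)$ if and only if either $T=Y$ or $T=Y\setminus\{2i\}$ for some $i\in[n]$. (3) If $T\not\subseteq X$ and $T\not\subseteq Y$, then $T\in\mathcal{C}(G)$ if and only if $T=A\cup\{i+1 : i\in A\}$ for some $A\subseteq X$ with $|A|=n-2$.
   Context: $[m]=\{1,\ldots,m\}$. The crown graph $C_{n,n}$ is the bipartite graph with vertex set $[2n]$, parts $X=\{2i-1 : i\in[n]\}$ and $Y=\{2i : i\in[n]\}$, and edges $\{2i-1,2j\}$ for all $i,j\in[n]$ with $i\ne j$. For a finite simple graph $G$ and $T\subseteq V(G)$, let $\bar T=V(G)\setminus T$, let $G[\bar T]$ be the induced subgraph on $\bar T$, and let $c_G(T)$ be the number of connected components of $G[\bar T]$. $T$ has the cut point property if either $T=\emptyset$ or for each $i\in T$, $i$ is a cut vertex of $G[\bar T\cup\{i\}]$, i.e. $c_G(T)>c_G(T\setminus\{i\})$. $\mathcal{C}(G)$ is the set of all $T\subseteq V(G)$ with the cut point property. *)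

theory Defs
  imports "Graph_Theory.Graph_Theory"
begin

text \<open>
  As in the library, a finite simple graph is a finite loop-free symmetric digraph without multiple
  arcs (locale \<^locale>\<open>graph\<close>): the edge \<open>{u, v}\<close> is represented by the two arcs
  \<open>(u, v)\<close> and \<open>(v, u)\<close>.
\<close>

text \<open>The connected components are the maximal connected subgraphs (which are nonempty by the
  library's definition of connectedness, so that the empty graph has none).\<close>

definition components :: "('a, 'b) pre_digraph \<Rightarrow> ('a, 'b) pre_digraph set" where
  "components G = {H. pre_digraph.max_subgraph G Digraph_Component.connected H}"

definition num_components_without :: "('a, 'b) pre_digraph \<Rightarrow> 'a set \<Rightarrow> nat" where
  "num_components_without G T = card (components (G \<restriction> (verts G - T)))"

definition cut_point_property :: "('a, 'b) pre_digraph \<Rightarrow> 'a set \<Rightarrow> bool" where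
  "cut_point_property G T \<longleftrightarrow> T = {} \<or>
     (\<forall>i\<in>T. num_components_without G T > num_components_without G (T - {i}))"

definition cut_sets :: "('a, 'b) pre_digraph \<Rightarrow> 'a set set" where
  "cut_sets G = {T. T \<subseteq> verts G \<and> cut_point_property G T}"

definition crown_X :: "nat \<Rightarrow> nat set" where
  "crown_X n = {2 * i - 1 | i. i \<in> {1..n}}"

definition crown_Y :: "nat \<Rightarrow> nat set" where
  "crown_Y n = {2 * i | i. i \<in> {1..n}}"

definition crown_graph :: "nat \<Rightarrow> nat pair_pre_digraph" where
  "crown_graph n = \<lparr> pverts = {1..2 * n},
     parcs = {(2 * i - 1, 2 * j) | i j. i \<in> {1..n} \<and> j \<in> {1..n} \<and> i \<noteq> j}
           \<union> {(2 * j, 2 * i - 1) | i j. i \<in> {1..n} \<and> j \<in> {1..n} \<and> i \<noteq> j} \<rparr>"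

lemma pair_graph_crown_graph: "pair_graph (crown_graph n)"
proof
  have sub: "parcs (crown_graph n) \<subseteq> {1..2 * n} \<times> {1..2 * n}"
    by (auto simp: crown_graph_def)
  show "fst e \<in> pverts (crown_graph n)" "snd e \<in> pverts (crown_graph n)"
    if "e \<in> parcs (crown_graph n)" for e
    using that by (auto simp: crown_graph_def)
  show "finite (pverts (crown_graph n))"
    by (simp add: crown_graph_def)
  show "finite (parcs (crown_graph n))"
    using sub by (rule finite_subset) simp
  show "fst e \<noteq> snd e" if "e \<in> parcs (crown_graph n)" for e
    using that by (auto simp: crown_graph_def)
  show "symmetric (with_proj (crown_graph n))"
    unfolding symmetric_def arcs_ends_def arc_to_ends_def
    by (auto simp: crown_graph_def sym_def)
qed

lemma crown_X_Un_Y: "crown_X n \<union> crown_Y n = {1..2 * n}" "crown_X n \<inter> crown_Y n = {}"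
proof -
  have "v \<in> crown_X n \<union> crown_Y n" if "v \<in> {1..2 * n}" for v
  proof (cases "even v")
    case True
    then obtain k where "v = 2 * k" by blast
    then show ?thesis using that by (auto simp: crown_Y_def)
  next
    case False
    then obtain k where "v = 2 * k + 1" by (blast elim: oddE)
    then have "v = 2 * Suc k - 1" "Suc k \<in> {1..n}" using that by auto
    then show ?thesis unfolding crown_X_def by blast
  qed
  moreover have "crown_X n \<union> crown_Y n \<subseteq> {1..2 * n}"
    by (auto simp: crown_X_def crown_Y_def)
  ultimately show "crown_X n \<union> crown_Y n = {1..2 * n}"
    by blast
  show "crown_X n \<inter> crown_Y n = {}"
    by (auto simp: crown_X_def crown_Y_def) presburger
qed

end

theory Submission
  imports Defs
begin

text \<open>
  Write the vertices as \<open>x\<^sub>i = 2 * i - 1\<close> and \<open>y\<^sub>i = 2 * i\<close>, and describe what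
  is left after the removal of \<open>T\<close> by two index sets: \<open>x\<^sub>i\<close> survives for \<open>i \<in> I\<close> and
  \<open>y\<^sub>j\<close> for \<open>j \<in> J\<close>. Two surviving vertices are adjacent exactly if they lie on different sides
  and have different indices. Taking a vertex out of \<open>T\<close> inserts one index into \<open>I\<close> or \<open>J\<close>, so
  the cut point property says that each such insertion lowers the number of components; in
  particular the graph on \<open>(I, J)\<close> must be disconnected.

  The crown graph is so dense that very few pairs \<open>(I, J)\<close> give a disconnected graph. As soon as
  every \<open>y\<^sub>j\<close> has a neighbour and any two \<open>x\<^sub>i\<close> have a common neighbour, everything is
  connected (\<open>count_connected\<close>). Applying this with either side in the leading role leaves only
  (\<open>crown_disconnected_cases\<close>): one side is empty; one side is a single index that also occurs on
  the other side, which gives an isolated vertex and a star; or \<open>I = J = {i, k}\<close>, which gives two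
  disjoint edges.

  If \<open>T\<close> lies in one side, the other side is complete. Then \<open>I = {}\<close> gives \<open>n\<close> isolated
  vertices, \<open>I = {i}\<close> gives two components and larger \<open>I\<close> gives one; since \<open>n \<ge> 3\<close>, the
  numbers \<open>n > 2 > 1\<close> decrease strictly, and these first two cases are the cut sets. If \<open>T\<close> meets
  both sides, there is an index to insert on either side. If one side is empty, inserting into the
  other adds a component; if one side is a single index that occurs on the other side, inserting
  into that other side keeps the number two. So both are excluded; from two disjoint edges any
  insertion gives a connected graph.
  Hence \<open>I = J\<close> has two elements, that is, \<open>T\<close> consists of \<open>n - 2\<close> full pairs
  \<open>{x\<^sub>i, y\<^sub>i}\<close>.
\<close>

section \<open>Counting the components of a symmetric digraph\<close>

lemma (in sym_digraph) induce_connected_imp_strongly_connected: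
  assumes "subgraph H G" "connected H"
  shows "strongly_connected (G \<restriction> verts H)"
proof -
  have sub: "verts H \<subseteq> verts G"
    using assms(1) by (rule subgraph_imp_subverts)
  interpret H': sym_digraph "G \<restriction> verts H"
    using sub by (intro induced_graph_imp_graph induced_induce)
  have "spanning H (G \<restriction> verts H)"
    using assms(1) by (auto simp: spanning_def intro: subgraph_induce_subgraphI2)
  then have "connected (G \<restriction> verts H)"
    using assms(2) by (rule H'.connected_spanning_imp_connected)
  then show ?thesis
    by (intro H'.symmetric_connected_imp_strongly_connected H'.sym_arcs)
qed

lemma (in wf_digraph) strongly_connected_imp_connected:
  assumes "strongly_connected G"
  shows "connected G"
  using assms by (intro connectedI) (auto simp: strongly_connected_def intro: reachable_mk_symmetricI)

text \<open>
  Maximality is meant here among all subgraphs, including subgraphs that are not symmetric and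
  therefore may be connected without being strongly connected. Passing from such a subgraph to the
  one induced on its vertices restores the symmetry, so that both notions have the same maximal
  subgraphs and the theory of strongly connected components applies.
\<close>

lemma (in sym_digraph) components_eq_sccs: "components G = sccs"
proof -
  have "max_subgraph strongly_connected H" if max: "max_subgraph connected H" for H
  proof -
    have sub: "subgraph H G" and con: "connected H"
      using max by (simp_all add: max_subgraph_def)
    then have sc: "strongly_connected (G \<restriction> verts H)"
      by (rule induce_connected_imp_strongly_connected)
    then have "connected (G \<restriction> verts H)"
      by (intro wf_digraph.strongly_connected_imp_connected wellformed_induce_subgraph)
    moreover have "subgraph H (G \<restriction> verts H)" "subgraph (G \<restriction> verts H) G"
      using sub by (auto intro: subgraph_induce_subgraphI2 subgraph_induce_subgraphI)
    ultimately have "G \<restriction> verts H = H"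
      using max by (auto simp: max_subgraph_def)
    with sc have "strongly_connected H" by simp
    moreover have "strongly_connected K \<Longrightarrow> \<not> (H \<noteq> K \<and> subgraph H K \<and> subgraph K G)" for K
      using max wf_digraph.strongly_connected_imp_connected[of K]
      by (auto simp: max_subgraph_def subgraph_def)
    ultimately show ?thesis
      using sub by (intro max_subgraphI) auto
  qed
  moreover have "max_subgraph connected H" if max: "max_subgraph strongly_connected H" for H
  proof (rule max_subgraphI)
    show sub: "subgraph H G" using max by (simp add: max_subgraph_def)
    then show "connected H"
      using max by (auto simp: max_subgraph_def intro: wf_digraph.strongly_connected_imp_connected)
  next
    fix K assume K: "H \<noteq> K" "subgraph H K" "subgraph K G"
    show "\<not> connected K"
    proof
      assume "connected K"
      with K have sc: "strongly_connected (G \<restriction> verts K)"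
        by (intro induce_connected_imp_strongly_connected)
      have sub: "subgraph K (G \<restriction> verts K)" "subgraph (G \<restriction> verts K) G"
        using K by (auto intro: subgraph_induce_subgraphI2 subgraph_induce_subgraphI)
      then have "G \<restriction> verts K = H"
        using max sc subgraph_trans[OF K(2) sub(1)] by (auto simp: max_subgraph_def)
      then have "subgraph K H"
        using sub(1) by simp
      with K(1,2) show False
        unfolding subgraph_def compatible_def by (metis (full_types) pre_digraph.equality subset_antisym unit.exhaust)
    qed
  qed
  ultimately show ?thesis
    unfolding components_def sccs_altdef2 by blast
qed

text \<open>
  A partition into internally linked parts with no arc leaving a part must be the partition into
  components: no walk leaves a part, so the parts are the reachability classes. All exact
  component counts below are obtained by exhibiting such a partition.
\<close>

lemma (in sym_digraph) sccs_verts_eq_partition: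
  assumes cover: "\<Union>P = verts G"
    and nonempty: "{} \<notin> P"
    and linked: "\<And>S u v. S \<in> P \<Longrightarrow> u \<in> S \<Longrightarrow> v \<in> S \<Longrightarrow> u \<rightarrow>\<^sup>* v"
    and closed: "\<And>S u v. S \<in> P \<Longrightarrow> u \<in> S \<Longrightarrow> u \<rightarrow>\<^bsub>G\<^esub> v \<Longrightarrow> v \<in> S"
  shows "sccs_verts = P"
proof -
  have stay: "v \<in> S" if "u \<rightarrow>\<^sup>* v" "S \<in> P" "u \<in> S" for S u v
    using that
  proof (induction rule: reachable_induct)
    case (step x y)
    then show ?case using closed[of S x y] by blast
  qed
  have scc: "scc_of u = S" if "S \<in> P" "u \<in> S" for S u
  proof
    show "scc_of u \<subseteq> S"
      using stay[of u _ S] that by (auto simp: scc_of_def)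
    show "S \<subseteq> scc_of u"
      using linked[OF that(1) that(2)] linked[OF that(1) _ that(2)] by (auto simp: scc_of_def)
  qed
  show ?thesis
  proof
    show "sccs_verts \<subseteq> P"
    proof
      fix S assume "S \<in> sccs_verts"
      then obtain u where "u \<in> \<Union>P" "S = scc_of u"
        using cover by (auto simp: sccs_verts_conv_scc_of)
      with scc show "S \<in> P" by blast
    qed
    show "P \<subseteq> sccs_verts"
    proof
      fix S assume "S \<in> P"
      with nonempty obtain u where "u \<in> S" by (cases "S = {}") auto
      moreover from this have "u \<in> verts G"
        using \<open>S \<in> P\<close> cover by blast
      ultimately show "S \<in> sccs_verts"
        using scc[OF \<open>S \<in> P\<close>] by (auto simp: sccs_verts_conv_scc_of)
    qed
  qed
qed

lemma (in sym_digraph) card_components_partition: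
  assumes "\<Union>P = verts G" "{} \<notin> P"
    and "\<And>S u v. S \<in> P \<Longrightarrow> u \<in> S \<Longrightarrow> v \<in> S \<Longrightarrow> u \<rightarrow>\<^sup>* v"
    and "\<And>S u v. S \<in> P \<Longrightarrow> u \<in> S \<Longrightarrow> u \<rightarrow>\<^bsub>G\<^esub> v \<Longrightarrow> v \<in> S"
  shows "card (components G) = card P"
  using sccs_verts_eq_partition[OF assms] card_sccs_verts components_eq_sccs by simp

lemma (in sym_digraph) card_components_pos:
  assumes "finite (verts G)" "verts G \<noteq> {}"
  shows "card (components G) > 0"
proof -
  have "card (components G) = card (scc_of ` verts G)"
    using card_sccs_verts components_eq_sccs sccs_verts_conv_scc_of by simp
  with assms show ?thesis by (simp add: card_gt_0_iff)
qed


section \<open>Induced subgraphs of the crown graph\<close>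

text \<open>
  The flag selects the side of the bipartition (false for the odd vertices, true for the even
  ones). Keeping it as a parameter makes every statement below available for both sides at once.
\<close>

definition crown_vertex :: "bool \<Rightarrow> nat \<Rightarrow> nat" where
  "crown_vertex b i = (if b then 2 * i else 2 * i - 1)"

lemma crown_vertex_eq_iff:
  assumes "i \<ge> 1" "j \<ge> 1"
  shows "crown_vertex b i = crown_vertex c j \<longleftrightarrow> b = c \<and> i = j"
  using assms unfolding crown_vertex_def by (cases b; cases c; simp; presburger)

text \<open>
  The first index set belongs to side \<open>b\<close>, the second one to the opposite side, so that exchanging
  the sides amounts to negating \<open>b\<close> and swapping the index sets.
\<close>

definition crown_verts :: "bool \<Rightarrow> nat set \<Rightarrow> nat set \<Rightarrow> nat set" where
  "crown_verts b I J = crown_vertex b ` I \<union> crown_vertex (\<not> b) ` J"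

definition crown_count :: "nat \<Rightarrow> bool \<Rightarrow> nat set \<Rightarrow> nat set \<Rightarrow> nat" where
  "crown_count n b I J = card (components (with_proj (crown_graph n) \<restriction> crown_verts b I J))"

lemma crown_verts_swap: "crown_verts (\<not> b) J I = crown_verts b I J"
  by (auto simp: crown_verts_def)

lemma crown_count_swap: "crown_count n (\<not> b) J I = crown_count n b I J"
  by (simp add: crown_count_def crown_verts_swap)

lemma crown_vertex_image: "crown_vertex False ` {1..n} = crown_X n" "crown_vertex True ` {1..n} = crown_Y n"
  by (auto simp: crown_vertex_def crown_X_def crown_Y_def)

lemma crown_verts_full: "crown_verts b {1..n} {1..n} = {1..2 * n}"
  using crown_X_Un_Y(1)[of n] unfolding crown_verts_def crown_vertex_image[symmetric]
  by (cases b) (simp_all add: Un_commute)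

lemma crown_adjacent_iff:
  assumes "i \<in> {1..n}" "j \<in> {1..n}"
  shows "(crown_vertex b i, crown_vertex c j) \<in> parcs (crown_graph n) \<longleftrightarrow> b \<noteq> c \<and> i \<noteq> j"
proof -
  have "parcs (crown_graph n) = {(crown_vertex b i, crown_vertex (\<not> b) j) | b i j.
      i \<in> {1..n} \<and> j \<in> {1..n} \<and> i \<noteq> j}" (is "_ = ?E")
  proof
    show "parcs (crown_graph n) \<subseteq> ?E"
      unfolding crown_graph_def crown_vertex_def by (auto; metis)
    show "?E \<subseteq> parcs (crown_graph n)"
      unfolding crown_graph_def crown_vertex_def by auto
  qed
  moreover have "(\<exists>d k l. crown_vertex b i = crown_vertex d k \<and> crown_vertex c j = crown_vertex (\<not> d) l \<and>
      k \<in> {1..n} \<and> l \<in> {1..n} \<and> k \<noteq> l) \<longleftrightarrow> b \<noteq> c \<and> i \<noteq> j"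
    using assms by (fastforce simp: crown_vertex_eq_iff)
  ultimately show ?thesis by blast
qed

lemma crown_vertex_mem_iff:
  assumes "I \<subseteq> {1..n}" "J \<subseteq> {1..n}" "i \<in> {1..n}"
  shows "crown_vertex c i \<in> crown_verts b I J \<longleftrightarrow> (if c = b then i \<in> I else i \<in> J)"
  using assms by (auto simp: crown_verts_def crown_vertex_eq_iff subset_iff)

lemma crown_verts_complement:
  assumes IJ: "I \<subseteq> {1..n}" "J \<subseteq> {1..n}"
  shows "{1..2 * n} - crown_verts b I J = crown_verts b ({1..n} - I) ({1..n} - J)"
proof -
  have "crown_vertex b i \<in> crown_verts b I J \<longleftrightarrow> i \<in> I"
    "crown_vertex (\<not> b) i \<in> crown_verts b I J \<longleftrightarrow> i \<in> J" if "i \<in> {1..n}" for i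
    using that IJ by (simp_all add: crown_vertex_mem_iff)
  then show ?thesis
    unfolding crown_verts_full[of b n, symmetric] crown_verts_def[of b "{1..n}"]
      crown_verts_def[of b "{1..n} - I"] by blast
qed

lemma crown_verts_eq_iff:
  assumes "I \<subseteq> {1..n}" "J \<subseteq> {1..n}" "I' \<subseteq> {1..n}" "J' \<subseteq> {1..n}"
  shows "crown_verts b I J = crown_verts b I' J' \<longleftrightarrow> I = I' \<and> J = J'"
proof
  assume eq: "crown_verts b I J = crown_verts b I' J'"
  have "(i \<in> I \<longleftrightarrow> i \<in> I') \<and> (i \<in> J \<longleftrightarrow> i \<in> J')" if "i \<in> {1..n}" for i
    using that assms eq crown_vertex_mem_iff[of I n J i b b] crown_vertex_mem_iff[of I n J i "\<not> b" b]
      crown_vertex_mem_iff[of I' n J' i b b] crown_vertex_mem_iff[of I' n J' i "\<not> b" b] by simp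
  with assms show "I = I' \<and> J = J'" by blast
qed simp

locale crown_piece =
  fixes n :: nat and b :: bool and I J :: "nat set"
  assumes I: "I \<subseteq> {1..n}" and J: "J \<subseteq> {1..n}"
begin

abbreviation "piece \<equiv> with_proj (crown_graph n) \<restriction> crown_verts b I J"

lemma crown_verts_subset: "crown_verts b I J \<subseteq> {1..2 * n}"
  using I J unfolding crown_verts_full[of b, symmetric] by (auto simp: crown_verts_def)

sublocale sym_digraph piece
proof -
  interpret crown: pair_graph "crown_graph n" by (rule pair_graph_crown_graph)
  show "sym_digraph piece"
    using crown_verts_subset
    by (intro crown.induced_graph_imp_graph crown.induced_induce) (simp add: crown_graph_def)
qed

lemma adjacent:
  assumes "i \<in> I" "j \<in> J" "i \<noteq> j"
  shows "crown_vertex b i \<rightarrow>\<^bsub>piece\<^esub> crown_vertex (\<not> b) j" "crown_vertex (\<not> b) j \<rightarrow>\<^bsub>piece\<^esub> crown_vertex b i"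
proof -
  have "i \<in> {1..n}" "j \<in> {1..n}" using assms I J by auto
  then show "crown_vertex b i \<rightarrow>\<^bsub>piece\<^esub> crown_vertex (\<not> b) j" "crown_vertex (\<not> b) j \<rightarrow>\<^bsub>piece\<^esub> crown_vertex b i"
    using assms crown_adjacent_iff[of i n j b "\<not> b"] crown_adjacent_iff[of j n i "\<not> b" b]
    by (auto simp: arcs_ends_conv crown_verts_def)
qed

lemma vertex_reachable_refl:
  "i \<in> I \<Longrightarrow> crown_vertex b i \<rightarrow>\<^sup>*\<^bsub>piece\<^esub> crown_vertex b i"
  "j \<in> J \<Longrightarrow> crown_vertex (\<not> b) j \<rightarrow>\<^sup>*\<^bsub>piece\<^esub> crown_vertex (\<not> b) j"
  by (rule reachable_refl, simp add: crown_verts_def)+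

lemma adjacentE:
  assumes "u \<rightarrow>\<^bsub>piece\<^esub> v"
  obtains i j where "i \<in> I" "j \<in> J" "i \<noteq> j"
    "u = crown_vertex b i \<and> v = crown_vertex (\<not> b) j \<or> u = crown_vertex (\<not> b) j \<and> v = crown_vertex b i"
proof -
  have uv: "(u, v) \<in> parcs (crown_graph n)" "u \<in> crown_verts b I J" "v \<in> crown_verts b I J"
    using assms by (auto simp: arcs_ends_conv)
  then obtain c i d j where
    "u = crown_vertex c i" "v = crown_vertex d j" "c = b \<and> i \<in> I \<or> c \<noteq> b \<and> i \<in> J"
    "d = b \<and> j \<in> I \<or> d \<noteq> b \<and> j \<in> J"
    unfolding crown_verts_def by blast
  moreover from this have "i \<in> {1..n}" "j \<in> {1..n}" using I J by auto
  ultimately show thesis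
    using uv(1) that[of i j] that[of j i] crown_adjacent_iff[of i n j c d] by auto
qed

lemma count_pos:
  assumes "I \<noteq> {} \<or> J \<noteq> {}"
  shows "crown_count n b I J > 0"
proof -
  have "finite (crown_verts b I J)"
    using crown_verts_subset by (rule finite_subset) simp
  moreover have "crown_verts b I J \<noteq> {}" using assms by (auto simp: crown_verts_def)
  ultimately show ?thesis
    unfolding crown_count_def by (intro card_components_pos) auto
qed

text \<open>
  The common neighbours put all vertices of side \<open>b\<close> into one component, and each vertex of the
  opposite side is attached to it by one of its neighbours. For a single vertex on side \<open>b\<close> the
  condition on common neighbours is void, so stars are covered as well.
\<close>

lemma count_connected:
  assumes "I \<noteq> {}"
    and nbr: "\<And>j. j \<in> J \<Longrightarrow> \<exists>i\<in>I. i \<noteq> j"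
    and common: "\<And>i k. i \<in> I \<Longrightarrow> k \<in> I \<Longrightarrow> i \<noteq> k \<Longrightarrow> \<exists>j\<in>J. j \<noteq> i \<and> j \<noteq> k"
  shows "crown_count n b I J = 1"
proof -
  have same: "crown_vertex b i \<rightarrow>\<^sup>*\<^bsub>piece\<^esub> crown_vertex b k" if "i \<in> I" "k \<in> I" for i k
  proof (cases "i = k")
    case True
    with that show ?thesis by (simp add: vertex_reachable_refl)
  next
    case False
    with that common obtain j where "j \<in> J" "j \<noteq> i" "j \<noteq> k" by blast
    with that have "crown_vertex b i \<rightarrow>\<^sup>*\<^bsub>piece\<^esub> crown_vertex (\<not> b) j"
      "crown_vertex (\<not> b) j \<rightarrow>\<^sup>*\<^bsub>piece\<^esub> crown_vertex b k"
      by (auto intro!: adjacent)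
    then show ?thesis by (rule reachable_trans)
  qed
  obtain h where h: "h \<in> I" using assms(1) by blast
  have to_h: "u \<rightarrow>\<^sup>*\<^bsub>piece\<^esub> crown_vertex b h" if u: "u \<in> crown_verts b I J" for u
  proof -
    consider i where "i \<in> I" "u = crown_vertex b i" | j where "j \<in> J" "u = crown_vertex (\<not> b) j"
      using u unfolding crown_verts_def by blast
    then show ?thesis
    proof cases
      case 1
      with h show ?thesis by (simp add: same)
    next
      case 2
      with nbr obtain i where "i \<in> I" "i \<noteq> j" by blast
      with 2 have "u \<rightarrow>\<^sup>*\<^bsub>piece\<^esub> crown_vertex b i"
        by (auto intro!: adjacent)
      then show ?thesis
        using same[OF \<open>i \<in> I\<close> h] by (rule reachable_trans)
    qed
  qed
  have "card (components piece) = card {crown_verts b I J}"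
  proof (rule card_components_partition)
    show "{} \<notin> {crown_verts b I J}" using h by (auto simp: crown_verts_def)
    show "u \<rightarrow>\<^sup>*\<^bsub>piece\<^esub> v" if "S \<in> {crown_verts b I J}" "u \<in> S" "v \<in> S" for S u v
      using that to_h symmetric_reachable' reachable_trans by (metis singletonD)
    show "v \<in> S" if "S \<in> {crown_verts b I J}" "u \<in> S" "u \<rightarrow>\<^bsub>piece\<^esub> v" for S u v
      using that adj_in_verts[of u v] by simp
  qed simp
  then show ?thesis by (simp add: crown_count_def)
qed

lemma count_independent:
  assumes "J = {}"
  shows "crown_count n b I J = card I"
proof -
  have "card (components piece) = card ((\<lambda>i. {crown_vertex b i}) ` I)"
  proof (rule card_components_partition)
    show "\<Union>((\<lambda>i. {crown_vertex b i}) ` I) = verts piece"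
      using assms by (auto simp: crown_verts_def)
    then show "u \<rightarrow>\<^sup>*\<^bsub>piece\<^esub> v" if "S \<in> (\<lambda>i. {crown_vertex b i}) ` I" "u \<in> S" "v \<in> S" for S u v
      using that by blast
    show "v \<in> S" if "u \<rightarrow>\<^bsub>piece\<^esub> v" for S u v
      using that assms by (elim adjacentE) simp
  qed auto
  also have "\<dots> = card I"
    using I crown_vertex_eq_iff by (intro card_image inj_onI) (auto simp: subset_iff)
  finally show ?thesis by (simp add: crown_count_def)
qed

text \<open>
  The hubs \<open>h\<close> and \<open>h'\<close> are meant as centres of the two parts: linking each vertex to its hub
  suffices, and by symmetry only arcs leaving \<open>S\<close> have to be excluded.
\<close>

lemma count_two:
  assumes parts: "S \<union> S' = crown_verts b I J" "S \<inter> S' = {}" and S: "h \<in> S" and S': "h' \<in> S'"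
    and hub: "\<And>u. u \<in> S \<Longrightarrow> u \<rightarrow>\<^sup>*\<^bsub>piece\<^esub> h" "\<And>u. u \<in> S' \<Longrightarrow> u \<rightarrow>\<^sup>*\<^bsub>piece\<^esub> h'"
    and cross: "\<And>u v. u \<in> S \<Longrightarrow> u \<rightarrow>\<^bsub>piece\<^esub> v \<Longrightarrow> v \<in> S"
  shows "crown_count n b I J = 2"
proof -
  have "card (components piece) = card {S, S'}"
  proof (rule card_components_partition)
    show "\<Union>{S, S'} = verts piece" using parts by simp
    show "{} \<notin> {S, S'}" using S S' by auto
    show "u \<rightarrow>\<^sup>*\<^bsub>piece\<^esub> v" if "R \<in> {S, S'}" "u \<in> R" "v \<in> R" for R u v
      using that hub symmetric_reachable' reachable_trans by (metis insertE singletonD)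
    show "v \<in> R" if R: "R \<in> {S, S'}" "u \<in> R" and uv: "u \<rightarrow>\<^bsub>piece\<^esub> v" for R u v
    proof (cases "R = S")
      case True
      with R uv cross show ?thesis by blast
    next
      case False
      with R have "u \<in> S'" "R = S'" by auto
      moreover have "v \<in> S \<union> S'" using parts adj_in_verts[OF uv] by simp
      moreover have "v \<notin> S"
        using cross[of v u] graph_symmetric[OF uv] \<open>u \<in> S'\<close> parts(2) by blast
      ultimately show ?thesis by blast
    qed
  qed
  also have "\<dots> = 2"
    using S S' parts(2) by (auto simp: card_2_iff)
  finally show ?thesis by (simp add: crown_count_def)
qed

text \<open>
  The only vertex that could be adjacent to the twin \<open>crown_vertex (\<not> b) i\<close> is
  \<open>crown_vertex b i\<close>, which has the same index; so the twin is isolated and the rest is a star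
  around \<open>crown_vertex b i\<close>. The star may consist of its centre alone.
\<close>

lemma count_star:
  assumes Ii: "I = {i}" and iJ: "i \<in> J"
  shows "crown_count n b I J = 2"
proof (rule count_two)
  show "{crown_vertex (\<not> b) i} \<union> insert (crown_vertex b i) (crown_vertex (\<not> b) ` (J - {i})) = crown_verts b I J"
    using assms by (auto simp: crown_verts_def)
  have "i \<ge> 1" "\<forall>j\<in>J. j \<ge> 1" using iJ J by auto
  then show "{crown_vertex (\<not> b) i} \<inter> insert (crown_vertex b i) (crown_vertex (\<not> b) ` (J - {i})) = {}"
    by (auto simp: crown_vertex_eq_iff)
  show "v \<in> {crown_vertex (\<not> b) i}" if "u \<in> {crown_vertex (\<not> b) i}" "u \<rightarrow>\<^bsub>piece\<^esub> v" for u v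
    using that(2,1) Ii \<open>i \<ge> 1\<close> \<open>\<forall>j\<in>J. j \<ge> 1\<close> by (elim adjacentE) (auto simp: crown_vertex_eq_iff)
  show "u \<rightarrow>\<^sup>*\<^bsub>piece\<^esub> crown_vertex (\<not> b) i" if "u \<in> {crown_vertex (\<not> b) i}" for u
    using that iJ by (auto intro!: vertex_reachable_refl)
  show "u \<rightarrow>\<^sup>*\<^bsub>piece\<^esub> crown_vertex b i" if "u \<in> insert (crown_vertex b i) (crown_vertex (\<not> b) ` (J - {i}))" for u
  proof -
    have "crown_vertex (\<not> b) j \<rightarrow>\<^sup>*\<^bsub>piece\<^esub> crown_vertex b i" if "j \<in> J - {i}" for j
      using that Ii by (intro reachable_adjI adjacent) auto
    moreover have "crown_vertex b i \<rightarrow>\<^sup>*\<^bsub>piece\<^esub> crown_vertex b i"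
      by (rule vertex_reachable_refl) (simp add: Ii)
    ultimately show ?thesis using that by blast
  qed
qed auto

lemma count_matching:
  assumes "I = {i, k}" "J = {i, k}" "i \<noteq> k"
  shows "crown_count n b I J = 2"
proof (rule count_two)
  show "{crown_vertex b i, crown_vertex (\<not> b) k} \<union> {crown_vertex b k, crown_vertex (\<not> b) i} = crown_verts b I J"
    using assms by (auto simp: crown_verts_def)
  have ge: "i \<ge> 1" "k \<ge> 1" using assms I by auto
  then show "{crown_vertex b i, crown_vertex (\<not> b) k} \<inter> {crown_vertex b k, crown_vertex (\<not> b) i} = {}"
    using assms by (auto simp: crown_vertex_eq_iff)
  show "v \<in> {crown_vertex b i, crown_vertex (\<not> b) k}"
    if "u \<in> {crown_vertex b i, crown_vertex (\<not> b) k}" "u \<rightarrow>\<^bsub>piece\<^esub> v" for u v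
    using that(2,1) assms ge by (elim adjacentE) (auto simp: crown_vertex_eq_iff)
  have mem: "i \<in> I" "k \<in> I" "i \<in> J" "k \<in> J" using assms by auto
  show "u \<rightarrow>\<^sup>*\<^bsub>piece\<^esub> crown_vertex b i" if "u \<in> {crown_vertex b i, crown_vertex (\<not> b) k}" for u
    using that reachable_adjI[OF adjacent(2)[OF mem(1,4)]] vertex_reachable_refl(1)[OF mem(1)] assms(3)
    by blast
  show "u \<rightarrow>\<^sup>*\<^bsub>piece\<^esub> crown_vertex b k" if "u \<in> {crown_vertex b k, crown_vertex (\<not> b) i}" for u
    using that reachable_adjI[OF adjacent(2)[OF mem(2,3)]] vertex_reachable_refl(1)[OF mem(2)] assms(3)
    by blast
qed auto

end

text \<open>
  Outside the first four cases every vertex has a neighbour, so the criterion \<open>count_connected\<close>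
  can only fail, on either side, because two vertices have no common neighbour. Two indices
  \<open>i, k\<close> on one side without a common neighbour confine the other side to \<open>{i, k}\<close>; using this
  in both directions makes the two index sets equal.
\<close>

lemma crown_disconnected_cases:
  assumes IJ: "I \<subseteq> {1..n}" "J \<subseteq> {1..n}" and count: "crown_count n b I J \<ge> 2"
  obtains (left_empty) "I = {}" | (right_empty) "J = {}"
  | (left_single) i where "I = {i}" "i \<in> J"
  | (right_single) j where "J = {j}" "j \<in> I"
  | (matching) i k where "i \<noteq> k" "I = {i, k}" "J = {i, k}"
proof -
  interpret left: crown_piece n b I J using IJ by unfold_locales
  interpret right: crown_piece n "\<not> b" J I using IJ by unfold_locales
  have notleft: "\<not> ((\<forall>j\<in>J. \<exists>i\<in>I. i \<noteq> j) \<and> (\<forall>i\<in>I. \<forall>k\<in>I. i \<noteq> k \<longrightarrow> (\<exists>j\<in>J. j \<noteq> i \<and> j \<noteq> k)))"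
    if "I \<noteq> {}"
    using left.count_connected count that by fastforce
  have notright: "\<not> ((\<forall>i\<in>I. \<exists>j\<in>J. j \<noteq> i) \<and> (\<forall>j\<in>J. \<forall>k\<in>J. j \<noteq> k \<longrightarrow> (\<exists>i\<in>I. i \<noteq> j \<and> i \<noteq> k)))"
    if "J \<noteq> {}"
    using right.count_connected count that crown_count_swap[of n b J I] by fastforce
  consider "I = {}" | "J = {}" | i where "I = {i}" "i \<in> J" | j where "J = {j}" "j \<in> I"
    | "I \<noteq> {}" "J \<noteq> {}" "\<forall>j\<in>J. \<exists>i\<in>I. i \<noteq> j" "\<forall>i\<in>I. \<exists>j\<in>J. j \<noteq> i"
    by (metis insertCI subsetI subset_singletonD)
  then show thesis
  proof cases
    case 5
    obtain i k where ik: "i \<in> I" "k \<in> I" "i \<noteq> k" "J \<subseteq> {i, k}" using notleft 5 by blast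
    obtain j l where jl: "j \<in> J" "l \<in> J" "j \<noteq> l" "I \<subseteq> {j, l}" using notright 5 by blast
    show thesis using ik jl matching[of i k] by blast
  qed (use that in blast)+
qed


section \<open>The cut point property in terms of index sets\<close>

text \<open>
  Removing a vertex from \<open>T\<close> puts its index back into \<open>I\<close> or \<open>J\<close>, which turns the cut point
  property into a comparison of component counts.
\<close>

lemma mem_cut_sets_iff:
  assumes IJ: "I \<subseteq> {1..n}" "J \<subseteq> {1..n}"
    and T: "T = {1..2 * n} - crown_verts b I J" and ne: "T \<noteq> {}"
  shows "T \<in> cut_sets (with_proj (crown_graph n)) \<longleftrightarrow>
    (\<forall>i\<in>{1..n} - I. crown_count n b (insert i I) J < crown_count n b I J) \<and>
    (\<forall>j\<in>{1..n} - J. crown_count n b I (insert j J) < crown_count n b I J)"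
proof -
  have vs: "verts (with_proj (crown_graph n)) = {1..2 * n}" by (simp add: crown_graph_def)
  have sub: "crown_verts b I J \<subseteq> {1..2 * n}"
    using IJ by (intro crown_piece.crown_verts_subset) (simp add: crown_piece_def)
  have "T = crown_vertex b ` ({1..n} - I) \<union> crown_vertex (\<not> b) ` ({1..n} - J)"
    using T crown_verts_complement[OF IJ] by (simp add: crown_verts_def)
  then have T_ball: "(\<forall>t\<in>T. P t) \<longleftrightarrow> (\<forall>i\<in>{1..n} - I. P (crown_vertex b i)) \<and>
      (\<forall>j\<in>{1..n} - J. P (crown_vertex (\<not> b) j))" for P
    by blast
  have nT: "num_components_without (with_proj (crown_graph n)) T = crown_count n b I J"
  proof -
    have "{1..2 * n} - T = crown_verts b I J" using sub T by auto
    then show ?thesis by (simp only: num_components_without_def crown_count_def vs)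
  qed
  have nI: "num_components_without (with_proj (crown_graph n)) (T - {crown_vertex b i})
      = crown_count n b (insert i I) J" if "i \<in> {1..n}" for i
  proof -
    have "crown_vertex b i \<in> {1..2 * n}"
      using that crown_verts_full[of b n] by (auto simp: crown_verts_def)
    then have "{1..2 * n} - (T - {crown_vertex b i}) = crown_verts b (insert i I) J"
      using sub T by (auto simp: crown_verts_def)
    then show ?thesis by (simp only: num_components_without_def crown_count_def vs)
  qed
  have nJ: "num_components_without (with_proj (crown_graph n)) (T - {crown_vertex (\<not> b) j})
      = crown_count n b I (insert j J)" if "j \<in> {1..n}" for j
  proof -
    have "crown_vertex (\<not> b) j \<in> {1..2 * n}"
      using that crown_verts_full[of b n] by (auto simp: crown_verts_def)
    then have "{1..2 * n} - (T - {crown_vertex (\<not> b) j}) = crown_verts b I (insert j J)"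
      using sub T by (auto simp: crown_verts_def)
    then show ?thesis by (simp only: num_components_without_def crown_count_def vs)
  qed
  have "T \<in> cut_sets (with_proj (crown_graph n)) \<longleftrightarrow>
      (\<forall>t\<in>T. num_components_without (with_proj (crown_graph n)) (T - {t})
        < num_components_without (with_proj (crown_graph n)) T)"
    using ne T by (auto simp: cut_sets_def cut_point_property_def crown_graph_def)
  also have "\<dots> \<longleftrightarrow> (\<forall>i\<in>{1..n} - I. crown_count n b (insert i I) J < crown_count n b I J) \<and>
    (\<forall>j\<in>{1..n} - J. crown_count n b I (insert j J) < crown_count n b I J)"
    unfolding nT T_ball by (simp add: nI nJ)
  finally show ?thesis .
qed

text \<open>
  The counts for \<open>I\<close> of size zero, one and at least two are \<open>n\<close>, two and one. A count of one
  cannot be lowered any further, as a nonempty graph has a component; the first two drops are strict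
  because \<open>n \<ge> 3\<close>.
\<close>

lemma one_sided_cut_iff:
  assumes "n \<ge> 3" and I: "I \<subset> {1..n}"
  shows "(\<forall>i\<in>{1..n} - I. crown_count n b (insert i I) {1..n} < crown_count n b I {1..n}) \<longleftrightarrow>
    I = {} \<or> (\<exists>i\<in>{1..n}. I = {i})"
proof
  assume cut: "\<forall>i\<in>{1..n} - I. crown_count n b (insert i I) {1..n} < crown_count n b I {1..n}"
  obtain i where i: "i \<in> {1..n} - I" using I by blast
  interpret bigger: crown_piece n b "insert i I" "{1..n}"
    using i I by unfold_locales auto
  have "0 < crown_count n b (insert i I) {1..n}"
    by (rule bigger.count_pos) blast
  moreover have "crown_count n b (insert i I) {1..n} < crown_count n b I {1..n}"
    using cut i by blast
  ultimately have "crown_count n b I {1..n} \<ge> 2" by linarith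
  moreover have "card {1..n} \<ge> 3" using assms(1) by simp
  ultimately show "I = {} \<or> (\<exists>i\<in>{1..n}. I = {i})"
    using I by (elim crown_disconnected_cases[of I n "{1..n}" b, rotated 2])
      (auto simp: card_insert_if)
next
  have card: "card {1..n} \<ge> 3" using assms(1) by simp
  assume "I = {} \<or> (\<exists>i\<in>{1..n}. I = {i})"
  then show "\<forall>i\<in>{1..n} - I. crown_count n b (insert i I) {1..n} < crown_count n b I {1..n}"
  proof
    assume e: "I = {}"
    interpret crown_piece n "\<not> b" "{1..n}" "{}" by unfold_locales auto
    have "crown_count n b I {1..n} = n"
      using count_independent e crown_count_swap[of n b "{1..n}" "{}"] by simp
    moreover have "crown_count n b (insert i I) {1..n} = 2" if "i \<in> {1..n}" for i
      using that e by (intro crown_piece.count_star[of _ _ _ i]) (auto simp: crown_piece_def)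
    ultimately show ?thesis using assms(1) by simp
  next
    assume "\<exists>i\<in>{1..n}. I = {i}"
    then obtain i where i: "I = {i}" "i \<in> {1..n}" by blast
    have "crown_count n b I {1..n} = 2"
      using i by (intro crown_piece.count_star[of _ _ _ i]) (auto simp: crown_piece_def)
    moreover have "crown_count n b (insert k I) {1..n} = 1" if k: "k \<in> {1..n} - I" for k
    proof (rule crown_piece.count_connected)
      show "crown_piece n (insert k I) {1..n}" using i k by (auto simp: crown_piece_def)
      show "\<exists>l\<in>insert k I. l \<noteq> j" for j using i k by auto
      fix p q
      \<comment> \<open>Any two of the at least three indices leave a third one, hence a common neighbour.\<close>
      have "card ({1..n} - {p, q}) > 0"
        using card diff_card_le_card_Diff[of "{p, q}" "{1..n}"] card_insert_le_m1[of 2 "{q}" p]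
        by (auto simp: card_insert_if split: if_splits)
      then show "\<exists>l\<in>{1..n}. l \<noteq> p \<and> l \<noteq> q" by (auto simp: card_gt_0_iff)
    qed simp
    ultimately show ?thesis by simp
  qed
qed

text \<open>
  Indices are available for insertion on both sides. In each disconnected case other than the two
  disjoint edges, some insertion fails to lower the count: the one opposite the empty side if
  there is one, and the one opposite the single index for an isolated vertex and a star.
\<close>

lemma two_sided_cut_iff:
  assumes I: "I \<subset> {1..n}" and J: "J \<subset> {1..n}"
  shows "(\<forall>i\<in>{1..n} - I. crown_count n b (insert i I) J < crown_count n b I J) \<and>
      (\<forall>j\<in>{1..n} - J. crown_count n b I (insert j J) < crown_count n b I J) \<longleftrightarrow>
    (\<exists>i k. i \<noteq> k \<and> I = {i, k} \<and> J = {i, k})" (is "?cut \<longleftrightarrow> ?matching")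
proof
  assume cut: ?cut
  obtain i j where i: "i \<in> {1..n} - I" and j: "j \<in> {1..n} - J" using I J by blast
  have star: "crown_count n c {k} L = 2" if "k \<in> L" "L \<subseteq> {1..n}" for c k L
    using that by (intro crown_piece.count_star[of _ _ _ k]) (auto simp: crown_piece_def)
  have edgeless: "crown_count n c L {} = card L" if "L \<subseteq> {1..n}" for c L
    using that by (intro crown_piece.count_independent) (auto simp: crown_piece_def)
  have fin: "finite I" "finite J" using I J by (auto intro: finite_subset)
  interpret bigger: crown_piece n b "insert i I" J
    using i I J by unfold_locales auto
  have "0 < crown_count n b (insert i I) J"
    by (rule bigger.count_pos) blast
  moreover have less_I: "crown_count n b (insert i I) J < crown_count n b I J"
    and less_J: "crown_count n b I (insert j J) < crown_count n b I J"
    using cut i j by blast+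
  ultimately have "crown_count n b I J \<ge> 2" by linarith
  with I J show ?matching
  proof (elim crown_disconnected_cases[of I n J b, rotated 2])
    assume e: "I = {}"
    have "crown_count n b I K = card K" if "K \<subseteq> {1..n}" for K
      using edgeless[of K "\<not> b"] that e crown_count_swap[of n b K "{}"] by simp
    then show ?thesis using less_J j J fin by (simp add: card_insert_if)
  next
    assume e: "J = {}"
    then show ?thesis using less_I i I fin edgeless[of _ b] by (simp add: card_insert_if)
  next
    fix k assume "I = {k}" "k \<in> J"
    then have two: "crown_count n b I K = 2" if "J \<subseteq> K" "K \<subseteq> {1..n}" for K
      using star[of k K b] that by auto
    have "crown_count n b I (insert j J) = 2" "crown_count n b I J = 2"
      using j J by (auto intro!: two)
    then show ?thesis using less_J by simp
  next
    fix k assume "J = {k}" "k \<in> I"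
    then have two: "crown_count n b K J = 2" if "I \<subseteq> K" "K \<subseteq> {1..n}" for K
      using star[of k K "\<not> b"] that crown_count_swap[of n b J K] by auto
    have "crown_count n b (insert i I) J = 2" "crown_count n b I J = 2"
      using i I by (auto intro!: two)
    then show ?thesis using less_I by simp
  qed auto
next
  assume ?matching
  then obtain i k where ik: "i \<noteq> k" "I = {i, k}" "J = {i, k}" by blast
  \<comment> \<open>The inserted vertex is adjacent to both vertices of the opposite side and so joins the two edges.\<close>
  have add: "crown_count n c {i, k} (insert l {i, k}) = 1" if "l \<in> {1..n} - {i, k}" for c l
    using that ik I by (intro crown_piece.count_connected) (auto simp: crown_piece_def)
  have "crown_count n b I J = 2"
    using ik I J by (intro crown_piece.count_matching) (auto simp: crown_piece_def)
  moreover have "crown_count n b (insert l I) J = 1" if "l \<in> {1..n} - I" for l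
    using add[of l "\<not> b"] ik that crown_count_swap[of n b J "insert l I"] by simp
  moreover have "crown_count n b I (insert l J) = 1" if "l \<in> {1..n} - J" for l
    using add[of l b] ik that by simp
  ultimately show ?cut by auto
qed

lemma one_sided_mem_cut_sets_iff:
  assumes "n \<ge> 3" and T: "T \<subseteq> crown_vertex b ` {1..n}" "T \<noteq> {}"
  shows "T \<in> cut_sets (with_proj (crown_graph n)) \<longleftrightarrow>
    T = crown_vertex b ` {1..n} \<or> (\<exists>i\<in>{1..n}. T = crown_vertex b ` {1..n} - {crown_vertex b i})"
proof -
  have inj: "inj_on (crown_vertex b) {1..n}"
    by (auto intro!: inj_onI simp: crown_vertex_eq_iff)
  from T(1) obtain A where A: "A \<subseteq> {1..n}" "T = crown_vertex b ` A"
    by (auto simp: subset_image_iff)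
  define I where "I = {1..n} - A"
  have T_I: "T = crown_vertex b ` ({1..n} - I)"
    using A by (simp add: I_def double_diff)
  have I: "I \<subset> {1..n}" using A T(2) by (auto simp: I_def)
  have disj: "crown_vertex b ` {1..n} \<inter> crown_vertex (\<not> b) ` {1..n} = {}"
    by (auto simp: crown_vertex_eq_iff)
  have "T = {1..2 * n} - crown_verts b I {1..n}"
    unfolding T_I crown_verts_full[of b n, symmetric] crown_verts_def
    using inj_on_image_set_diff[OF inj, of "{1..n}" I] I disj by auto
  then have "T \<in> cut_sets (with_proj (crown_graph n)) \<longleftrightarrow> I = {} \<or> (\<exists>i\<in>{1..n}. I = {i})"
    using mem_cut_sets_iff[of I n "{1..n}" T b] one_sided_cut_iff[OF assms(1) I, of b] I T(2) by auto
  moreover have "T = crown_vertex b ` {1..n} - crown_vertex b ` K \<longleftrightarrow> I = K" if "K \<subseteq> {1..n}" for K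
  proof -
    have "T = crown_vertex b ` {1..n} - crown_vertex b ` K \<longleftrightarrow>
        crown_vertex b ` ({1..n} - I) = crown_vertex b ` ({1..n} - K)"
      using inj_on_image_set_diff[OF inj, of "{1..n}" K] that by (simp add: T_I)
    also have "\<dots> \<longleftrightarrow> {1..n} - I = {1..n} - K"
      by (rule inj_on_image_eq_iff[OF inj]) auto
    finally show ?thesis using I that by blast
  qed
  from this[of "{}"] this[of "{i}" for i]
  have "T = crown_vertex b ` {1..n} \<longleftrightarrow> I = {}"
    "\<And>i. i \<in> {1..n} \<Longrightarrow> T = crown_vertex b ` {1..n} - {crown_vertex b i} \<longleftrightarrow> I = {i}" by auto
  ultimately show ?thesis by auto
qed

text \<open>
  The removed indices are the complement of the two surviving ones. The assumption on \<open>n\<close> matters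
  because of truncated subtraction: only then does \<open>card K = n - 2\<close> leave exactly two indices.
\<close>

lemma two_sided_mem_cut_sets_iff:
  assumes n: "n \<ge> 2" and T: "T \<subseteq> {1..2 * n}" "\<not> T \<subseteq> crown_X n" "\<not> T \<subseteq> crown_Y n"
  shows "T \<in> cut_sets (with_proj (crown_graph n)) \<longleftrightarrow>
    (\<exists>K\<subseteq>{1..n}. card K = n - 2 \<and> T = crown_verts False K K)"
proof -
  define I J where "I = {i \<in> {1..n}. crown_vertex False i \<notin> T}"
    and "J = {i \<in> {1..n}. crown_vertex True i \<notin> T}"
  have IJ: "I \<subseteq> {1..n}" "J \<subseteq> {1..n}" by (auto simp: I_def J_def)
  have compl: "{1..2 * n} - crown_verts False I J = crown_verts False ({1..n} - I) ({1..n} - J)"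
    using IJ by (rule crown_verts_complement)
  have T_IJ: "T = crown_verts False ({1..n} - I) ({1..n} - J)"
  proof
    show "crown_verts False ({1..n} - I) ({1..n} - J) \<subseteq> T"
      by (auto simp: crown_verts_def I_def J_def)
    show "T \<subseteq> crown_verts False ({1..n} - I) ({1..n} - J)"
    proof
      fix t assume t: "t \<in> T"
      with T(1) have "t \<in> crown_verts False {1..n} {1..n}"
        unfolding crown_verts_full by blast
      with t show "t \<in> crown_verts False ({1..n} - I) ({1..n} - J)"
        unfolding crown_verts_def I_def J_def by auto
    qed
  qed
  have "I \<noteq> {1..n}" "J \<noteq> {1..n}"
    using T(2,3) unfolding crown_vertex_image[symmetric] T_IJ crown_verts_def by auto
  with IJ have "I \<subset> {1..n}" "J \<subset> {1..n}" by auto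
  moreover have "T \<noteq> {}" using T(2) by blast
  ultimately have "T \<in> cut_sets (with_proj (crown_graph n)) \<longleftrightarrow>
      (\<exists>i k. i \<noteq> k \<and> I = {i, k} \<and> J = {i, k})"
    using mem_cut_sets_iff[OF IJ, of T False] two_sided_cut_iff[of I n J False] unfolding compl
    by (simp only: T_IJ[symmetric] simp_thms)
  also have "\<dots> \<longleftrightarrow> I = J \<and> card I = 2"
    by (auto simp: card_2_iff)
  also have "\<dots> \<longleftrightarrow> (\<exists>K\<subseteq>{1..n}. card K = n - 2 \<and> {1..n} - I = K \<and> {1..n} - J = K)"
  proof
    assume "I = J \<and> card I = 2"
    moreover from this IJ have "card ({1..n} - I) = n - 2"
      by (subst card_Diff_subset) (auto intro: finite_subset)
    ultimately show "\<exists>K\<subseteq>{1..n}. card K = n - 2 \<and> {1..n} - I = K \<and> {1..n} - J = K"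
      by blast
  next
    assume "\<exists>K\<subseteq>{1..n}. card K = n - 2 \<and> {1..n} - I = K \<and> {1..n} - J = K"
    then obtain K where K: "K \<subseteq> {1..n}" "card K = n - 2" "{1..n} - I = K" "{1..n} - J = K"
      by blast
    with IJ have "I = {1..n} - K" "J = {1..n} - K" by blast+
    moreover have "card ({1..n} - K) = n - (n - 2)"
      using K(1,2) by (subst card_Diff_subset) (auto intro: finite_subset)
    ultimately show "I = J \<and> card I = 2" using n by simp
  qed
  also have "\<dots> \<longleftrightarrow> (\<exists>K\<subseteq>{1..n}. card K = n - 2 \<and> T = crown_verts False K K)"
    unfolding T_IJ using crown_verts_eq_iff[of "{1..n} - I" n "{1..n} - J"] by (metis Diff_subset)
  finally show ?thesis .
qed

lemma crown_verts_diagonal: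
  assumes "K \<subseteq> {1..n}"
  shows "crown_verts False K K = crown_vertex False ` K \<union> {i + 1 | i. i \<in> crown_vertex False ` K}"
proof -
  have "crown_vertex True k = crown_vertex False k + 1" if "k \<in> K" for k
    using that assms by (auto simp: crown_vertex_def)
  then show ?thesis by (auto simp: crown_verts_def)
qed

theorem theorem3p3:
  fixes n :: nat and T :: "nat set"
  assumes "n \<ge> 3"
    and "T \<subseteq> {1..2 * n}" and "T \<noteq> {}"
  shows "(T \<subseteq> crown_X n \<longrightarrow>
           (T \<in> cut_sets (with_proj (crown_graph n)) \<longleftrightarrow>
              T = crown_X n \<or> (\<exists>i\<in>{1..n}. T = crown_X n - {2 * i - 1})))
       \<and> (T \<subseteq> crown_Y n \<longrightarrow>
           (T \<in> cut_sets (with_proj (crown_graph n)) \<longleftrightarrow>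
              T = crown_Y n \<or> (\<exists>i\<in>{1..n}. T = crown_Y n - {2 * i})))
       \<and> (\<not> T \<subseteq> crown_X n \<and> \<not> T \<subseteq> crown_Y n \<longrightarrow>
           (T \<in> cut_sets (with_proj (crown_graph n)) \<longleftrightarrow>
              (\<exists>A. A \<subseteq> crown_X n \<and> card A = n - 2 \<and> T = A \<union> {i + 1 | i. i \<in> A})))"
proof (intro conjI impI)
  assume "T \<subseteq> crown_X n"
  then show "T \<in> cut_sets (with_proj (crown_graph n)) \<longleftrightarrow>
      T = crown_X n \<or> (\<exists>i\<in>{1..n}. T = crown_X n - {2 * i - 1})"
    using one_sided_mem_cut_sets_iff[of n T False] assms
    unfolding crown_vertex_image by (simp add: crown_vertex_def)
next
  assume "T \<subseteq> crown_Y n"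
  then show "T \<in> cut_sets (with_proj (crown_graph n)) \<longleftrightarrow>
      T = crown_Y n \<or> (\<exists>i\<in>{1..n}. T = crown_Y n - {2 * i})"
    using one_sided_mem_cut_sets_iff[of n T True] assms
    unfolding crown_vertex_image by (simp add: crown_vertex_def)
next
  assume "\<not> T \<subseteq> crown_X n \<and> \<not> T \<subseteq> crown_Y n"
  then have "T \<in> cut_sets (with_proj (crown_graph n)) \<longleftrightarrow>
      (\<exists>K\<subseteq>{1..n}. card K = n - 2 \<and> T = crown_verts False K K)"
    using assms by (intro two_sided_mem_cut_sets_iff) auto
  also have "\<dots> \<longleftrightarrow> (\<exists>K\<subseteq>{1..n}. card (crown_vertex False ` K) = n - 2 \<and>
      T = crown_vertex False ` K \<union> {i + 1 | i. i \<in> crown_vertex False ` K})"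
  proof -
    have "card (crown_vertex False ` K) = card K" if "K \<subseteq> {1..n}" for K
      using that by (intro card_image inj_onI) (auto simp: crown_vertex_eq_iff subset_iff)
    then show ?thesis by (intro ex_cong1) (auto simp: crown_verts_diagonal)
  qed
  also have "\<dots> \<longleftrightarrow> (\<exists>A. A \<subseteq> crown_X n \<and> card A = n - 2 \<and> T = A \<union> {i + 1 | i. i \<in> A})"
    unfolding crown_vertex_image(1)[symmetric] subset_image_iff by blast
  finally show "T \<in> cut_sets (with_proj (crown_graph n)) \<longleftrightarrow>
      (\<exists>A. A \<subseteq> crown_X n \<and> card A = n - 2 \<and> T = A \<union> {i + 1 | i. i \<in> A})" .
qed

end
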